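(* Let $R$ be a commutative ring with unity and let $m,n,p,q$ be positive integers with $m+n\geq 4$ satisfying at least one of the following conditions: (i) $m=n=2$, $p=1$, and $q\geq 2$; (ii) $m\geq 2$, $n\geq 1$, $p=2m-3$, and $q=1$; (iii) $m\geq 3$, $m+1\leq n\leq 3m-p-3$, $1\leq p\leq 2m-4$, and $q=(p-m-n+3)/(m-n)$. Let $\Lambda=E(x)$ be an exterior $R$-algebra generated by $x$ of degree $p$. Let $H=E(y)$ be an exterior $\Lambda$-algebra generated by $y$ of degree $q$, let $\mu$ and $\Delta$ denote the trivial product and the primitive coproduct on $H$, and define the $\Lambda$-multilinear operation $\omega_m^n:H^{\otimes m}\rightarrow H^{\otimes n}$ by $\omega_m^n(y|\cdots|y)=xy|y|\cdots|y$ and by zero on all other tensor monomials in the basis elements $1,y$. Then $(H,\Delta,\mu,\omega_m^n)$ is an $A_\infty$-bialgebra of type $(m,n)$.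
   Context: **Conventions.** All tensor products are over the graded commutative ring $\Lambda$, and the Koszul sign convention is used throughout: $(f\otimes g)(a\otimes b)=(-1)^{|g||a|}f(a)\otimes g(b)$, permutations of tensor factors carry Koszul signs, and scalars from $\Lambda$ are moved through tensors with Koszul signs, so e.g. $yx|y=y|xy=(-1)^{|x||y|}x(y|y)$. The bar $a|b$ denotes $a\otimes b$. $Hom^k(A,B)$ denotes the $\Lambda$-linear maps of degree $k$ (raising degree by $k$). $\mathbf 1$ denotes the identity map of $H$. $\Lambda=E(x)$ is the graded algebra with $R$-basis $1,x$ and $x^2=0$. $H=E(y)$ is the free $\Lambda$-module on $1,y$. The trivial product $\mu$ has $1$ as unit and $\mu(y|y)=0$. The primitive coproduct is given by $\Delta(1)=1|1$ and $\Delta(y)=1|y+y|1$. **Notation.** Let $H$ be a graded $\Lambda$-module with product $\mu:H^{\otimes 2}\to H$ and coproduct $\Delta:H\to H^{\otimes 2}$ of degree $0$. - For a map $f$, $f_{i,j}=\mathbf 1^{\otimes i}\otimes f\otimes\mathbf 1^{\otimes j}$. - $\delta^k=\sum_{i=1}^k(-1)^{i+1}\Delta_{i-1,k-i}:H^{\otimes k}\to H^{\otimes k+1}$ and $\partial_k=\sum_{i=1}^k(-1)^{i+1}\mu_{i-1,k-i}:H^{\otimes k+1}\to H^{\otimes k}$. - $f^1=g_1=\mathbf 1$, and for $m,n\ge 2$, $f^n=(\Delta\otimes\mathbf 1^{\otimes n-2})\cdots(\Delta\otimes\mathbf 1)\Delta:H\to H^{\otimes n}$ and $g_m=\mu(\mu\otimes\mathbf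 1)\cdots(\mu\otimes\mathbf 1^{\otimes m-2}):H^{\otimes m}\to H$ are the iterated coproduct and product. - $\sigma_{q,p}:(H^{\otimes q})^{\otimes p}\to(H^{\otimes p})^{\otimes q}$ is the standard permutation of tensor factors (the $j$-th factor of the $i$-th block becomes the $i$-th factor of the $j$-th block). In $\sigma_{q,p}$ the letters $p,q$ are merely indices. **Definition.** Let $m,n$ be positive integers with $m+n\ge 4$. An *$A_\infty$-bialgebra of type $(m,n)$* is a graded $\Lambda$-Hopf algebra $(H,\Delta,\mu)$ (so $\mu$ is associative, $\Delta$ is coassociative, and $\Delta\mu=(\mu\otimes\mu)\sigma_{2,2}(\Delta\otimes\Delta)$) together with an operation $\omega_m^n\in Hom^{m+n-3}(H^{\otimes m},H^{\otimes n})$ such that the relations below hold. The specific sign choices at the symbols $\pm$ are left unspecified; here the relations containing $\pm$ are to be understood as holding for every choice of these signs. 1. $\delta^n\omega_m^n=\left(g_m\otimes\omega_m^n-(-1)^n\omega_m^n\otimes g_m\right)\sigma_{2,m}\Delta^{\otimes m}$. 2. $\omega_m^n\partial_m=\mu^{\otimes n}\sigma_{n,2}\left(f^n\otimes\omega_m^n-(-1)^m\omega_m^n\otimes f^n\right)$. 3. $\left(\omega_m^n\otimes g_m^{\otimes n-1}\pm g_m\otimes\omega_m^n\otimes g_m^{\otimes n-2}\pm\cdots\pm g_m^{\otimes n-1}\otimes\omega_m^n\right)\sigma_{n,m}\left(\omega_m^n\otimes(f^n)^{\otimes m-1}\pm f^n\otimes\omega_m^n\otimes(f^n)^{\otimes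 m-2}\pm\cdots\pm(f^n)^{\otimes m-1}\otimes\omega_m^n\right)=0$. 4. If $m=2$, then: - (a) $(\omega_2^n\otimes\omega_2^n)\sigma_{2,2}(\Delta\otimes\Delta)=0$; - (b), (c), … for each $0\le k\le n-2$, $\Big[\sum\pm\theta_1\otimes\cdots\otimes\theta_n\Big]\sigma_{n,2}\left(f^n\otimes\omega_2^n-\omega_2^n\otimes f^n\right)=0$, where the sum runs over all $(\theta_1,\dots,\theta_n)$ with exactly $k$ of the $\theta_i$ equal to $\mu$ and the other $n-k$ equal to $\omega_2^n$ (for $k=0$ the bracket is $(\omega_2^n)^{\otimes n}$); - (d) $\Big[\sum_{j=0}^{n-1}(-1)^{j(n+1)}\mu^{\otimes n-1-j}\otimes\omega_2^n\otimes\mu^{\otimes j}\Big]\sigma_{n,2}\left(f^n\otimes\omega_2^n-\omega_2^n\otimes f^n\right)=0$. 5. If $n=2$, then: - (a) $(\mu\otimes\mu)\sigma_{2,2}(\omega_m^2\otimes\omega_m^2)=0$; - (b), (c), … for each $0\le k\le m-2$, $\left(g_m\otimes\omega_m^2-\omega_m^2\otimes g_m\right)\sigma_{2,m}\Big[\sum\pm\theta_1\otimes\cdots\otimes\theta_m\Big]=0$, where the sum runs over all $(\theta_1,\dots,\theta_m)$ with exactly $k$ of the $\theta_i$ equal to $\Delta$ and the other $m-k$ equal to $\omega_m^2$ (for $k=0$ the bracket is $(\omega_m^2)^{\otimes m}$); - (d) $\left(g_m\otimes\omega_m^2-\omega_m^2\otimes g_m\right)\sigma_{2,m}\Big[\sum_{j=0}^{m-1}(-1)^{j(m+1)}\Delta^{\otimes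 m-1-j}\otimes\omega_m^2\otimes\Delta^{\otimes j}\Big]=0$. 6. If $m=n=2$, then $(\omega_2^2\otimes\omega_2^2)\sigma_{2,2}(\omega_2^2\otimes\omega_2^2)=0$.
   Formalization: The formal theorem additionally assumes that q is odd or 2=0 in R; otherwise (e.g. R=Z, m=n=2, p=1, q=2) the Hopf relation for the primitive coproduct fails on y|y, where the two sides differ by (1+(-1)^q) y|y. *)

theory Defs
  imports Complex_Main "HOL-Library.Poly_Mapping"
begin

section \<open>The exterior algebra on one generator\<close>

text \<open>\<open>Ext a b\<close> stands for \<open>a + b x\<close> with \<open>x\<^sup>2 = 0\<close>.  Since \<open>x\<close> is the only generator, the
  underlying ungraded ring is commutative whatever the degree of \<open>x\<close>; that degree enters only
  through homogeneity and the Koszul signs below.\<close>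

datatype 'r exterior = Ext (const_part: 'r) (x_part: 'r)

instantiation exterior :: (comm_ring_1) comm_ring_1
begin

definition "0 = Ext 0 0"
definition "1 = Ext 1 0"
definition "a + b = Ext (const_part a + const_part b) (x_part a + x_part b)"
definition "a - b = Ext (const_part a - const_part b) (x_part a - x_part b)"
definition "- a = Ext (- const_part a) (- x_part a)"
definition "a * b = Ext (const_part a * const_part b)
                        (const_part a * x_part b + x_part a * const_part b)"

instance
  by standard
    (auto simp: zero_exterior_def one_exterior_def plus_exterior_def minus_exterior_def
      uminus_exterior_def times_exterior_def algebra_simps intro: exterior.expand)

end

definition ext_x :: "'r::comm_ring_1 exterior"
  where "ext_x = Ext 0 1"

definition ksign :: "int \<Rightarrow> 'a::ring_1"
  where "ksign d = (if even d then 1 else - 1)"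


section \<open>Tensor powers of a free graded module and their graded maps\<close>

text \<open>\<open>H\<close> is the free graded \<open>\<Lambda>\<close>-module on a homogeneous basis \<open>'b\<close>, where \<open>\<Lambda> = E(x)\<close>.  Its \<open>k\<close>-th
  tensor power over \<open>\<Lambda>\<close> is free on the tensor monomials, i.e. the words of length \<open>k\<close> in \<open>'b\<close>; an
  element is a finitely supported family of coefficients, written to the left of the words, and
  the empty word spans the zeroth tensor power \<open>\<Lambda>\<close>.\<close>

type_synonym ('b, 'r) tensor = "'b list \<Rightarrow>\<^sub>0 'r exterior"

text \<open>A map \<open>f\<close> from the \<open>k\<close>-th to the \<open>l\<close>-th tensor power, homogeneous of degree \<open>d\<close> and \<open>\<Lambda>\<close>-linear
  in the graded sense \<open>f(c v) = (-1)\<^bsup>d|c|\<^esup> c f(v)\<close>, is recorded by its source \<open>k\<close>, target \<open>l\<close>, degree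
  \<open>d\<close> and its values on tensor monomials.  Values on words of length other than \<open>k\<close> are
  irrelevant.\<close>

context
  notes [[typedef_overloaded]]
begin

datatype ('b, 'r) gmap =
  GMap (src: nat) (tgt: nat) (dgr: int) (val: "'b list \<Rightarrow> ('b, 'r::comm_ring_1) tensor")

end

definition scl :: "'r::comm_ring_1 exterior \<Rightarrow> ('b, 'r) tensor \<Rightarrow> ('b, 'r) tensor"
  where "scl c v = Poly_Mapping.map ((*) c) v"

definition gid :: "nat \<Rightarrow> ('b, 'r::comm_ring_1) gmap"
  where "gid k = GMap k k 0 (\<lambda>w. Poly_Mapping.single w 1)"

abbreviation idH :: "('b, 'r::comm_ring_1) gmap"  (\<open>\<one>\<close>)
  where "\<one> \<equiv> gid 1"

text \<open>The linear combination of the maps \<open>F a\<close>, all of them from the \<open>k\<close>-th to the \<open>l\<close>-th tensor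
  power and of degree \<open>d\<close>, with integer coefficients \<open>s a\<close>.\<close>

definition lincomb ::
  "nat \<Rightarrow> nat \<Rightarrow> int \<Rightarrow> 'i set \<Rightarrow> ('i \<Rightarrow> int) \<Rightarrow> ('i \<Rightarrow> ('b, 'r::comm_ring_1) gmap) \<Rightarrow> ('b, 'r) gmap"
  where "lincomb k l d A s F = GMap k l d (\<lambda>w. \<Sum>a\<in>A. scl (of_int (s a)) (val (F a) w))"

definition gminus ::
  "('b, 'r::comm_ring_1) gmap \<Rightarrow> ('b, 'r) gmap \<Rightarrow> ('b, 'r) gmap"  (infixl \<open>\<ominus>\<close> 65)
  where "f \<ominus> g = GMap (src f) (tgt f) (dgr f) (\<lambda>w. val f w - val g w)"

definition gscale :: "int \<Rightarrow> ('b, 'r::comm_ring_1) gmap \<Rightarrow> ('b, 'r) gmap"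
  where "gscale s f = GMap (src f) (tgt f) (dgr f) (\<lambda>w. scl (of_int s) (val f w))"

definition geq :: "('b, 'r::comm_ring_1) gmap \<Rightarrow> ('b, 'r) gmap \<Rightarrow> bool"  (infix \<open>\<approx>\<close> 50)
  where "f \<approx> g \<longleftrightarrow> src f = src g \<and> tgt f = tgt g \<and> dgr f = dgr g \<and>
                   (\<forall>w. length w = src f \<longrightarrow> val f w = val g w)"

definition gzero :: "('b, 'r::comm_ring_1) gmap \<Rightarrow> bool"
  where "gzero f \<longleftrightarrow> (\<forall>w. length w = src f \<longrightarrow> val f w = 0)"

definition sign_choice :: "('i \<Rightarrow> int) \<Rightarrow> bool"
  where "sign_choice s \<longleftrightarrow> (\<forall>i. s i \<in> {1, - 1})"

text \<open>In the following, \<open>p\<close> is the degree of \<open>x\<close> and \<open>bdeg\<close> gives the degrees of the basis of \<open>H\<close>.\<close>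

locale koszul =
  fixes p :: int and bdeg :: "'b \<Rightarrow> int"
begin

definition wdeg :: "'b list \<Rightarrow> int"
  where "wdeg w = sum_list (map bdeg w)"

definition ext_homogeneous :: "int \<Rightarrow> 'r::comm_ring_1 exterior \<Rightarrow> bool"
  where "ext_homogeneous e c \<longleftrightarrow> (const_part c \<noteq> 0 \<longrightarrow> e = 0) \<and> (x_part c \<noteq> 0 \<longrightarrow> e = p)"

definition Hom :: "int \<Rightarrow> nat \<Rightarrow> nat \<Rightarrow> ('b, 'r::comm_ring_1) gmap set"
  where "Hom d k l = {f. src f = k \<and> tgt f = l \<and> dgr f = d \<and>
     (\<forall>w u. length w = k \<longrightarrow> u \<in> Poly_Mapping.keys (val f w) \<longrightarrow>
        length u = l \<and>
        ext_homogeneous (wdeg w + d - wdeg u) (Poly_Mapping.lookup (val f w) u))}"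

text \<open>\<open>twist d c = (-1)\<^bsup>d|c|\<^esup> c\<close> for homogeneous \<open>c\<close>, extended additively: the sign for moving the
  scalar \<open>c\<close> past something of degree \<open>d\<close>.\<close>

definition twist :: "int \<Rightarrow> 'r::comm_ring_1 exterior \<Rightarrow> 'r exterior"
  where "twist d c = Ext (const_part c) (ksign (d * p) * x_part c)"

definition app :: "('b, 'r::comm_ring_1) gmap \<Rightarrow> ('b, 'r) tensor \<Rightarrow> ('b, 'r) tensor"
  where "app f v =
    (\<Sum>w\<in>Poly_Mapping.keys v. scl (twist (dgr f) (Poly_Mapping.lookup v w)) (val f w))"

definition gcomp ::
  "('b, 'r::comm_ring_1) gmap \<Rightarrow> ('b, 'r) gmap \<Rightarrow> ('b, 'r) gmap"  (infixl \<open>\<cdot>\<close> 70)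
  where "g \<cdot> f = GMap (src f) (tgt g) (dgr g + dgr f) (\<lambda>w. app g (val f w))"

text \<open>Concatenation \<open>a u | b v = (-1)\<^bsup>|u||b|\<^esup> a b (u|v)\<close> of tensors, for words \<open>u\<close>, \<open>v\<close> and scalars
  \<open>a\<close>, \<open>b\<close>.\<close>

definition conc :: "('b, 'r::comm_ring_1) tensor \<Rightarrow> ('b, 'r) tensor \<Rightarrow> ('b, 'r) tensor"
  where "conc s t =
    (\<Sum>u\<in>Poly_Mapping.keys s. \<Sum>v\<in>Poly_Mapping.keys t.
       Poly_Mapping.single (u @ v)
         (Poly_Mapping.lookup s u * twist (wdeg u) (Poly_Mapping.lookup t v)))"

definition gtensor ::
  "('b, 'r::comm_ring_1) gmap \<Rightarrow> ('b, 'r) gmap \<Rightarrow> ('b, 'r) gmap"  (infixr \<open>\<otimes>\<close> 75)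
  where "f \<otimes> g = GMap (src f + src g) (tgt f + tgt g) (dgr f + dgr g)
    (\<lambda>w. let a = take (src f) w; b = drop (src f) w
         in scl (ksign (dgr g * wdeg a)) (conc (val f a) (val g b)))"

definition gtensors :: "('b, 'r::comm_ring_1) gmap list \<Rightarrow> ('b, 'r) gmap"
  where "gtensors fs = foldr (\<otimes>) fs (gid 0)"

definition gpower :: "('b, 'r::comm_ring_1) gmap \<Rightarrow> nat \<Rightarrow> ('b, 'r) gmap"
  where "gpower f k = gtensors (replicate k f)"

definition insert_map :: "('b, 'r::comm_ring_1) gmap \<Rightarrow> nat \<Rightarrow> nat \<Rightarrow> ('b, 'r) gmap"
  where "insert_map f i j = gpower \<one> i \<otimes> f \<otimes> gpower \<one> j"

text \<open>The permutation of tensor factors which moves the factor at position \<open>\<pi> t\<close> to position \<open>t\<close>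
  (positions counted from 0), with the sign \<open>(-1)\<^bsup>|a||b|\<^esup>\<close> for every two factors \<open>a\<close>, \<open>b\<close> whose order
  is reversed.\<close>

definition permute_factors :: "nat \<Rightarrow> (nat \<Rightarrow> nat) \<Rightarrow> ('b, 'r::comm_ring_1) gmap"
  where "permute_factors N \<pi> = GMap N N 0
    (\<lambda>w. Poly_Mapping.single (map (\<lambda>t. w ! \<pi> t) [0..<N])
       (\<Prod>(s, t)\<in>{(s, t). s < t \<and> t < N \<and> \<pi> t < \<pi> s}. ksign (bdeg (w ! \<pi> s) * bdeg (w ! \<pi> t))))"

text \<open>The source consists of \<open>b\<close> blocks of length \<open>a\<close>, the target of \<open>a\<close> blocks of length \<open>b\<close>: position
  \<open>t = j b + i\<close> of the target receives the factor \<open>j\<close> of block \<open>i\<close>.\<close>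

definition \<sigma> :: "nat \<Rightarrow> nat \<Rightarrow> ('b, 'r::comm_ring_1) gmap"
  where "\<sigma> a b = permute_factors (a * b) (\<lambda>t. (t mod b) * a + t div b)"

definition cobar :: "('b, 'r::comm_ring_1) gmap \<Rightarrow> nat \<Rightarrow> ('b, 'r) gmap"
  where "cobar \<Delta> k =
    lincomb k (k + 1) 0 {1..k} (\<lambda>i. (- 1) ^ (i + 1)) (\<lambda>i. insert_map \<Delta> (i - 1) (k - i))"

definition bar :: "('b, 'r::comm_ring_1) gmap \<Rightarrow> nat \<Rightarrow> ('b, 'r) gmap"
  where "bar \<mu> k =
    lincomb (k + 1) k 0 {1..k} (\<lambda>i. (- 1) ^ (i + 1)) (\<lambda>i. insert_map \<mu> (i - 1) (k - i))"

text \<open>The iterated coproduct and product \<open>f\<^sup>n\<close> and \<open>g\<^sub>m\<close>; the value for index 0 is never used.\<close>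

fun iter_coproduct :: "('b, 'r::comm_ring_1) gmap \<Rightarrow> nat \<Rightarrow> ('b, 'r) gmap" where
  "iter_coproduct \<Delta> 0 = \<one>"
| "iter_coproduct \<Delta> (Suc 0) = \<one>"
| "iter_coproduct \<Delta> (Suc (Suc k)) = (\<Delta> \<otimes> gpower \<one> k) \<cdot> iter_coproduct \<Delta> (Suc k)"

fun iter_product :: "('b, 'r::comm_ring_1) gmap \<Rightarrow> nat \<Rightarrow> ('b, 'r) gmap" where
  "iter_product \<mu> 0 = \<one>"
| "iter_product \<mu> (Suc 0) = \<one>"
| "iter_product \<mu> (Suc (Suc k)) = iter_product \<mu> (Suc k) \<cdot> (\<mu> \<otimes> gpower \<one> k)"


section \<open>Hopf algebras and \<open>A\<^sub>\<infinity>\<close>-bialgebras of type \<open>(m,n)\<close>\<close>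

text \<open>Unit, counit and antipode are maps between \<open>H\<close> and the zeroth tensor power \<open>\<Lambda>\<close>.\<close>

definition hopf_algebra :: "('b, 'r::comm_ring_1) gmap \<Rightarrow> ('b, 'r) gmap \<Rightarrow> bool"
  where "hopf_algebra \<Delta> \<mu> \<longleftrightarrow>
    \<mu> \<in> Hom 0 2 1 \<and> \<Delta> \<in> Hom 0 1 2 \<and>
    \<mu> \<cdot> (\<mu> \<otimes> \<one>) \<approx> \<mu> \<cdot> (\<one> \<otimes> \<mu>) \<and>
    (\<Delta> \<otimes> \<one>) \<cdot> \<Delta> \<approx> (\<one> \<otimes> \<Delta>) \<cdot> \<Delta> \<and>
    \<Delta> \<cdot> \<mu> \<approx> (\<mu> \<otimes> \<mu>) \<cdot> \<sigma> 2 2 \<cdot> (\<Delta> \<otimes> \<Delta>) \<and>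
    (\<exists>\<eta> \<epsilon> S. \<eta> \<in> Hom 0 0 1 \<and> \<epsilon> \<in> Hom 0 1 0 \<and> S \<in> Hom 0 1 1 \<and>
       \<mu> \<cdot> (\<eta> \<otimes> \<one>) \<approx> \<one> \<and> \<mu> \<cdot> (\<one> \<otimes> \<eta>) \<approx> \<one> \<and>
       (\<epsilon> \<otimes> \<one>) \<cdot> \<Delta> \<approx> \<one> \<and> (\<one> \<otimes> \<epsilon>) \<cdot> \<Delta> \<approx> \<one> \<and>
       \<Delta> \<cdot> \<eta> \<approx> \<eta> \<otimes> \<eta> \<and> \<epsilon> \<cdot> \<mu> \<approx> \<epsilon> \<otimes> \<epsilon> \<and> \<epsilon> \<cdot> \<eta> \<approx> gid 0 \<and>
       \<mu> \<cdot> (S \<otimes> \<one>) \<cdot> \<Delta> \<approx> \<eta> \<cdot> \<epsilon> \<and> \<mu> \<cdot> (\<one> \<otimes> S) \<cdot> \<Delta> \<approx> \<eta> \<cdot> \<epsilon>)"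

text \<open>The two kinds of sums of tensor products in the relations below: one factor \<open>\<omega>\<close> in position \<open>i\<close> (counted
  from 0) among \<open>N - 1\<close> factors \<open>\<theta>\<close>, and factors \<open>\<theta>\<close> in \<open>k\<close> of the \<open>N\<close> positions (the set \<open>A\<close>) with \<open>\<omega>\<close>
  in all the others.\<close>

definition single_sum ::
  "('b, 'r::comm_ring_1) gmap \<Rightarrow> ('b, 'r) gmap \<Rightarrow> nat \<Rightarrow> (nat \<Rightarrow> int) \<Rightarrow> ('b, 'r) gmap"
  where "single_sum \<theta> \<omega> N s =
    lincomb (src \<omega> + (N - 1) * src \<theta>) (tgt \<omega> + (N - 1) * tgt \<theta>) (dgr \<omega> + int (N - 1) * dgr \<theta>)
      {..<N} s (\<lambda>i. gpower \<theta> i \<otimes> \<omega> \<otimes> gpower \<theta> (N - 1 - i))"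

definition mixed_sum ::
  "('b, 'r::comm_ring_1) gmap \<Rightarrow> ('b, 'r) gmap \<Rightarrow> nat \<Rightarrow> nat \<Rightarrow> (nat set \<Rightarrow> int) \<Rightarrow> ('b, 'r) gmap"
  where "mixed_sum \<theta> \<omega> N k s =
    lincomb (k * src \<theta> + (N - k) * src \<omega>) (k * tgt \<theta> + (N - k) * tgt \<omega>)
      (int k * dgr \<theta> + int (N - k) * dgr \<omega>)
      {A. A \<subseteq> {..<N} \<and> card A = k} s
      (\<lambda>A. gtensors (map (\<lambda>i. if i \<in> A then \<theta> else \<omega>) [0..<N]))"

text \<open>The relations with unspecified signs are required for every choice of the signs.  The fixed
  signs \<open>(-1)\<^bsup>j(N+1)\<^esup>\<close> belong to the term with \<open>j\<close> factors \<open>\<theta>\<close> to the right of \<open>\<omega>\<close>, that is, to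
  \<open>i = N - 1 - j\<close>.\<close>

definition A_infty_bialgebra ::
  "nat \<Rightarrow> nat \<Rightarrow> ('b, 'r::comm_ring_1) gmap \<Rightarrow> ('b, 'r) gmap \<Rightarrow> ('b, 'r) gmap \<Rightarrow> bool"
  where "A_infty_bialgebra m n \<Delta> \<mu> \<omega> \<longleftrightarrow>
    (let f = iter_coproduct \<Delta> n; g = iter_product \<mu> m in
    1 \<le> m \<and> 1 \<le> n \<and> 4 \<le> m + n \<and>
    hopf_algebra \<Delta> \<mu> \<and>
    \<omega> \<in> Hom (int m + int n - 3) m n \<and>
    cobar \<Delta> n \<cdot> \<omega> \<approx> (g \<otimes> \<omega> \<ominus> gscale ((- 1) ^ n) (\<omega> \<otimes> g)) \<cdot> \<sigma> 2 m \<cdot> gpower \<Delta> m \<and>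
    \<omega> \<cdot> bar \<mu> m \<approx> gpower \<mu> n \<cdot> \<sigma> n 2 \<cdot> (f \<otimes> \<omega> \<ominus> gscale ((- 1) ^ m) (\<omega> \<otimes> f)) \<and>
    (\<forall>s t. sign_choice s \<longrightarrow> s 0 = 1 \<longrightarrow> sign_choice t \<longrightarrow> t 0 = 1 \<longrightarrow>
       gzero (single_sum g \<omega> n s \<cdot> \<sigma> n m \<cdot> single_sum f \<omega> m t)) \<and>
    (m = 2 \<longrightarrow>
       gzero ((\<omega> \<otimes> \<omega>) \<cdot> \<sigma> 2 2 \<cdot> (\<Delta> \<otimes> \<Delta>)) \<and>
       (\<forall>k s. k + 2 \<le> n \<longrightarrow> sign_choice s \<longrightarrow>
          gzero (mixed_sum \<mu> \<omega> n k s \<cdot> \<sigma> n 2 \<cdot> (f \<otimes> \<omega> \<ominus> \<omega> \<otimes> f))) \<and>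
       gzero (single_sum \<mu> \<omega> n (\<lambda>i. (- 1) ^ ((n - 1 - i) * (n + 1))) \<cdot> \<sigma> n 2
              \<cdot> (f \<otimes> \<omega> \<ominus> \<omega> \<otimes> f))) \<and>
    (n = 2 \<longrightarrow>
       gzero ((\<mu> \<otimes> \<mu>) \<cdot> \<sigma> 2 2 \<cdot> (\<omega> \<otimes> \<omega>)) \<and>
       (\<forall>k s. k + 2 \<le> m \<longrightarrow> sign_choice s \<longrightarrow>
          gzero ((g \<otimes> \<omega> \<ominus> \<omega> \<otimes> g) \<cdot> \<sigma> 2 m \<cdot> mixed_sum \<Delta> \<omega> m k s)) \<and>
       gzero ((g \<otimes> \<omega> \<ominus> \<omega> \<otimes> g) \<cdot> \<sigma> 2 m
              \<cdot> single_sum \<Delta> \<omega> m (\<lambda>i. (- 1) ^ ((m - 1 - i) * (m + 1))))) \<and>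
    (m = 2 \<and> n = 2 \<longrightarrow> gzero ((\<omega> \<otimes> \<omega>) \<cdot> \<sigma> 2 2 \<cdot> (\<omega> \<otimes> \<omega>))))"

end


section \<open>The exterior algebra \<open>H = E(y)\<close> over \<open>\<Lambda>\<close>\<close>

datatype ybasis = One | Y

definition ydeg :: "nat \<Rightarrow> ybasis \<Rightarrow> int"
  where "ydeg q b = (case b of One \<Rightarrow> 0 | Y \<Rightarrow> int q)"

definition trivial_product :: "(ybasis, 'r::comm_ring_1) gmap"
  where "trivial_product = GMap 2 1 0
    (\<lambda>w. if w = [One, One] then Poly_Mapping.single [One] 1
         else if w = [One, Y] \<or> w = [Y, One] then Poly_Mapping.single [Y] 1
         else 0)"

definition primitive_coproduct :: "(ybasis, 'r::comm_ring_1) gmap"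
  where "primitive_coproduct = GMap 1 2 0
    (\<lambda>w. if w = [One] then Poly_Mapping.single [One, One] 1
         else if w = [Y] then Poly_Mapping.single [One, Y] 1 + Poly_Mapping.single [Y, One] 1
         else 0)"

definition omega :: "nat \<Rightarrow> nat \<Rightarrow> (ybasis, 'r::comm_ring_1) gmap"
  where "omega m n = GMap m n (int m + int n - 3)
    (\<lambda>w. if w = replicate m Y then Poly_Mapping.single (replicate n Y) ext_x else 0)"



section \<open>The degree of the generator \<open>y\<close>\<close>

lemma lookup_scl [simp]: "Poly_Mapping.lookup (scl c v) w = c * Poly_Mapping.lookup v w"
  unfolding scl_def by (simp add: Poly_Mapping.map.rep_eq when_def)

lemma scl_single [simp]: "scl c (Poly_Mapping.single w a) = Poly_Mapping.single w (c * a)"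
  by (rule poly_mapping_eqI) (simp add: lookup_single when_def)

lemma scl_0 [simp]: "scl c 0 = 0" "scl 0 v = 0"
  by (rule poly_mapping_eqI, simp)+

lemma scl_add [simp]: "scl c (u + v) = scl c u + scl c v"
  by (rule poly_mapping_eqI) (simp add: lookup_add algebra_simps)

lemma scl_1 [simp]: "scl 1 v = v" by (rule poly_mapping_eqI) simp

lemma scl_add2: "scl (a + b) v = scl a v + scl b v"
  by (rule poly_mapping_eqI) (simp add: lookup_add algebra_simps)

context koszul
begin

lemma twist_0 [simp]: "twist d 0 = 0" by (simp add: twist_def zero_exterior_def)

lemma twist_1 [simp]: "twist d 1 = 1" by (simp add: twist_def one_exterior_def)

lemma twist_deg0 [simp]: "twist 0 c = c" by (cases c) (simp add: twist_def ksign_def)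

lemma twist_add: "twist d (a + b) = twist d a + twist d b"
  by (simp add: twist_def plus_exterior_def algebra_simps)

lemma app_0 [simp]: "app f 0 = 0" by (simp add: app_def)

lemma app_super: assumes "finite A" "Poly_Mapping.keys v \<subseteq> A"
  shows "app f v = (\<Sum>w\<in>A. scl (twist (dgr f) (Poly_Mapping.lookup v w)) (val f w))"
  unfolding app_def using assms by (intro sum.mono_neutral_left) (auto simp: in_keys_iff)

lemma app_add [simp]: "app f (u + v) = app f u + app f v"
proof -
  let ?A = "Poly_Mapping.keys u \<union> Poly_Mapping.keys v"
  have "finite ?A" by simp
  moreover have "Poly_Mapping.keys (u+v) \<subseteq> ?A" by (rule Poly_Mapping.keys_add)
  ultimately show ?thesis
    by (simp add: app_super[of ?A] lookup_add twist_add scl_add2 sum.distrib)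
qed

lemma app_single [simp]: "app f (Poly_Mapping.single w c) = scl (twist (dgr f) c) (val f w)"
  by (cases "c = 0") (simp_all add: app_def)

lemma conc_super: assumes "finite A" "finite B" "Poly_Mapping.keys s \<subseteq> A" "Poly_Mapping.keys t \<subseteq> B"
  shows "conc s t = (\<Sum>u\<in>A. \<Sum>v\<in>B. Poly_Mapping.single (u @ v)
         (Poly_Mapping.lookup s u * twist (wdeg u) (Poly_Mapping.lookup t v)))"
proof -
  have "conc s t = (\<Sum>u\<in>Poly_Mapping.keys s. \<Sum>v\<in>B. Poly_Mapping.single (u @ v)
         (Poly_Mapping.lookup s u * twist (wdeg u) (Poly_Mapping.lookup t v)))"
    unfolding conc_def using assms
    by (intro sum.cong sum.mono_neutral_left) (auto simp: in_keys_iff)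
  also have "\<dots> = (\<Sum>u\<in>A. \<Sum>v\<in>B. Poly_Mapping.single (u @ v)
         (Poly_Mapping.lookup s u * twist (wdeg u) (Poly_Mapping.lookup t v)))"
    using assms by (intro sum.mono_neutral_left) (auto simp: in_keys_iff)
  finally show ?thesis .
qed

lemma conc_0 [simp]: "conc 0 t = 0" "conc s 0 = 0" by (simp_all add: conc_def)

lemma conc_add1 [simp]: "conc (s + s') t = conc s t + conc s' t"
proof -
  let ?A = "Poly_Mapping.keys s \<union> Poly_Mapping.keys s'"
  have "Poly_Mapping.keys (s+s') \<subseteq> ?A" by (rule Poly_Mapping.keys_add)
  then show ?thesis
    by (simp add: conc_super[of ?A "Poly_Mapping.keys t"] lookup_add algebra_simps single_add sum.distrib)
qed

lemma conc_add2 [simp]: "conc s (t + t') = conc s t + conc s t'"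
proof -
  let ?A = "Poly_Mapping.keys t \<union> Poly_Mapping.keys t'"
  have "Poly_Mapping.keys (t+t') \<subseteq> ?A" by (rule Poly_Mapping.keys_add)
  then show ?thesis
    by (simp add: conc_super[of "Poly_Mapping.keys s" ?A] lookup_add twist_add algebra_simps single_add sum.distrib)
qed

lemma conc_single [simp]: "conc (Poly_Mapping.single u a) (Poly_Mapping.single v b)
   = Poly_Mapping.single (u @ v) (a * twist (wdeg u) b)"
  by (cases "a = 0"; cases "b = 0") (simp_all add: conc_def)

end

text \<open>With the Koszul sign \<open>(-1)\<^bsup>q q\<^esup>\<close>, the two sides of the compatibility relation differ by
  \<open>(1 + (-1)\<^sup>q) y|y\<close> on \<open>y|y\<close>.  Hence \<open>E(y)\<close> with the primitive coproduct is a Hopf algebra only if \<open>y\<close>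
  has odd degree or the ground ring has characteristic 2, the usual proviso on generators of
  exterior Hopf algebras.\<close>

lemma hopf_algebra_imp_odd_or_two_eq_0:
  assumes "koszul.hopf_algebra p (ydeg q) (primitive_coproduct :: (ybasis, 'r::comm_ring_1) gmap) trivial_product"
  shows "odd q \<or> (2::'r) = 0"
proof (rule ccontr)
  assume A: "\<not> (odd q \<or> (2::'r) = 0)"
  interpret koszul p "ydeg q" .
  let ?\<Delta> = "primitive_coproduct :: (ybasis, 'r) gmap" and ?\<mu> = "trivial_product :: (ybasis, 'r) gmap"
  have perm: "{(s, t). s < t \<and> t < 4 \<and> t mod 2 * 2 + t div 2 < s mod 2 * 2 + s div 2} = {(1::nat,2::nat)}" (is "?L = _")
  proof -
    have "?L = Set.filter (\<lambda>(s,t). s < t \<and> t mod 2 * 2 + t div 2 < s mod 2 * 2 + s div 2) ({..<4} \<times> {..<4})" by auto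
    also have "\<dots> = {(1,2)}" by code_simp
    finally show ?thesis .
  qed
  have srcD: "src (gcomp ?\<Delta> ?\<mu>) = 2" by (simp add: gcomp_def trivial_product_def)
  have len: "length [Y,Y] = 2" by simp
  have u4: "[0..<4] = [0,1,2,3]" by (simp add: upt_rec)
  have "geq (gcomp ?\<Delta> ?\<mu>) (gcomp (gcomp (gtensor ?\<mu> ?\<mu>) (\<sigma> 2 2)) (gtensor ?\<Delta> ?\<Delta>))"
    using assms by (simp add: hopf_algebra_def)
  then have "val (gcomp ?\<Delta> ?\<mu>) [Y,Y] = val (gcomp (gcomp (gtensor ?\<mu> ?\<mu>) (\<sigma> 2 2)) (gtensor ?\<Delta> ?\<Delta>)) [Y,Y]"
    unfolding geq_def by (metis (no_types, lifting) srcD len)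
  then have "Poly_Mapping.single [Y,Y] (1 + 1 :: 'r exterior) = 0"
    using A unfolding single_add
    by (simp add: gcomp_def gtensor_def trivial_product_def primitive_coproduct_def \<sigma>_def permute_factors_def
       perm ksign_def ydeg_def wdeg_def u4 Let_def)
  then have "(1 + 1 :: 'r exterior) = 0" by (metis lookup_single_eq lookup_zero)
  then have "(1 + 1 :: 'r) = 0" by (simp add: zero_exterior_def one_exterior_def plus_exterior_def)
  with A show False by simp
qed

end

theory Submission
  imports Defs
begin

text \<open>
  The values of \<open>\<omega>\<close> are multiples of \<open>x\<close>.  Composing or tensoring with any other map keeps this
  property, and \<open>x\<^sup>2 = 0\<close>; hence a composite in which both maps involve \<open>\<omega>\<close> vanishes
  (\<open>gzero_gcomp\<close>), and so does \<open>\<omega> \<otimes> \<omega>\<close> (\<open>val_gtensor_x_valued\<close>).  This settles every relation in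
  which \<open>\<omega>\<close> occurs quadratically, whatever signs are chosen in it.

  The two relations linear in \<open>\<omega>\<close> are dual to each other and are checked on words in \<open>1\<close> and \<open>y\<close>.
  In \<open>\<delta>\<^sup>n \<omega>(y|\<dots>|y)\<close> the coproduct of the \<open>i\<close>-th factor contributes, up to the sign \<open>(-1)\<^bsup>i+1\<^esup>\<close> and the
  scalar \<open>x\<close>, the two words with \<open>n\<close> letters \<open>y\<close> and a single \<open>1\<close> just before and just after the
  \<open>i\<close>-th \<open>y\<close>.  Neighbouring terms cancel (\<open>alternating_telescope\<close>), and only the words with \<open>1\<close> at
  one of the ends remain, the second with sign \<open>(-1)\<^bsup>n+1\<^esup>\<close>.  On the other side, \<open>\<omega>\<close> is fed with
  one tensor factor of each \<open>\<Delta>(a)\<close>, and it needs every one of them to be \<open>y\<close>; as \<open>y\<close> is primitive,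
  all the complementary factors are then \<open>1\<close>.  Thus \<open>g\<^sub>m \<otimes> \<omega>\<close> and \<open>\<omega> \<otimes> g\<^sub>m\<close> see one word each, and
  they give exactly the two remaining terms (\<open>coproduct_relation\<close>).  In \<open>\<omega> \<partial>\<^sub>m\<close> the same cancellation
  takes place according to the position of the single \<open>1\<close> in the argument, while
  \<open>\<mu>(y|y) = 0\<close> removes every term of the right-hand side in which \<open>f\<^sup>n\<close> is applied to \<open>y\<close>
  (\<open>product_relation\<close>).

  In the terms of these two relations that survive, each pair of factors interchanged by a
  permutation contains a \<open>1\<close>, so that no Koszul sign appears.  A sign from interchanging two letters
  \<open>y\<close> matters only in the compatibility of \<open>\<Delta>\<close> and \<open>\<mu>\<close>: on \<open>y|y\<close> it reads \<open>(1 + (-1)\<^bsup>q q\<^esup>) y|y = 0\<close>, which is the reason for assuming \<open>q\<close> odd or \<open>2 = 0\<close>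
  (\<open>hopf_algebra_E_y\<close>).

  Each of the three families of parameters satisfies \<open>m q + (m + n - 3) = p + n q\<close>, which says that
  \<open>\<omega>\<close> is homogeneous of degree \<open>m + n - 3\<close>.
\<close>

section \<open>Scalars and linear extension\<close>

lemma const_part_simps [simp]:
  "const_part (0 :: 'r::comm_ring_1 exterior) = 0"
  "const_part (a + b) = const_part a + const_part (b :: 'r exterior)"
  "const_part (a - b) = const_part a - const_part (b :: 'r exterior)"
  "const_part (a * b) = const_part a * const_part (b :: 'r exterior)"
  "const_part (ext_x :: 'r exterior) = 0"
  by (simp_all add: zero_exterior_def plus_exterior_def minus_exterior_def times_exterior_def
      ext_x_def)

lemma of_int_exterior: "(of_int k :: 'r::comm_ring_1 exterior) = Ext (of_int k) 0"
proof -
  have nat: "(of_nat j :: 'r exterior) = Ext (of_nat j) 0" for j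
    by (induction j) (simp_all add: zero_exterior_def plus_exterior_def one_exterior_def)
  show ?thesis
    by (cases k rule: int_diff_cases) (simp add: nat minus_exterior_def)
qed

lemma ksign_0 [simp]: "ksign 0 = 1"
  by (simp add: ksign_def)

lemma scl_scl [simp]: "scl a (scl b v) = scl (a * b) v"
  by (rule poly_mapping_eqI) (simp add: mult.assoc)

lemma scl_minus [simp]: "scl c (u - v) = scl c u - scl c v"
  by (rule poly_mapping_eqI) (simp add: lookup_minus algebra_simps)

lemma scl_sum: "scl c (sum F A) = (\<Sum>a\<in>A. scl c (F a))"
  by (induction A rule: infinite_finite_induct) simp_all

lemma gmap_components [simp]:
  "src (gid k) = k" "tgt (gid k) = k" "dgr (gid k) = 0"
  "src (lincomb k l d A s F) = k" "tgt (lincomb k l d A s F) = l" "dgr (lincomb k l d A s F) = d"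
  "src (f \<ominus> g) = src f" "tgt (f \<ominus> g) = tgt f" "dgr (f \<ominus> g) = dgr f"
  "src (gscale c f) = src f" "tgt (gscale c f) = tgt f" "dgr (gscale c f) = dgr f"
  by (simp_all add: gid_def lincomb_def gminus_def gscale_def)

lemma val_lincomb: "val (lincomb k l d A s F) w = (\<Sum>a\<in>A. scl (of_int (s a)) (val (F a) w))"
  by (simp add: lincomb_def)

context koszul
begin

lemma const_part_twist [simp]: "const_part (twist d c) = const_part c"
  by (simp add: twist_def)

lemma twist_of_int_mult: "twist d (of_int k * c) = of_int k * twist d c"
  by (simp add: twist_def of_int_exterior times_exterior_def algebra_simps)

text \<open>Integers lie in degree 0 of \<open>\<Lambda>\<close>, so they pass through maps of any degree without a sign.\<close>

lemma app_of_int: "app f (scl (of_int k) v) = scl (of_int k) (app f v)"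
proof -
  have "Poly_Mapping.keys (scl (of_int k) v) \<subseteq> Poly_Mapping.keys v"
    by (auto simp: in_keys_iff)
  then show ?thesis
    by (subst app_super[of "Poly_Mapping.keys v"])
      (simp_all add: app_def twist_of_int_mult scl_sum)
qed

lemma app_sum: "app f (sum F A) = (\<Sum>a\<in>A. app f (F a))"
  by (induction A rule: infinite_finite_induct) simp_all

lemma app_minus: "app f (u - v) = app f u - app f v"
  by (metis add_diff_cancel_right' app_add diff_add_cancel)

lemma app_gscale: "app (gscale k f) v = scl (of_int k) (app f v)"
  by (simp add: app_def gscale_def scl_sum twist_of_int_mult mult.commute)

lemma app_gminus: "dgr f = dgr g \<Longrightarrow> app (f \<ominus> g) v = app f v - app g v"
  by (simp add: app_def gminus_def sum_subtractf)

lemma conc_sum1: "conc (sum F A) t = (\<Sum>a\<in>A. conc (F a) t)"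
  by (induction A rule: infinite_finite_induct) simp_all

lemma conc_sum2: "conc s (sum F A) = (\<Sum>a\<in>A. conc s (F a))"
  by (induction A rule: infinite_finite_induct) simp_all

lemma gcomp_components [simp]:
  "src (g \<cdot> f) = src f" "tgt (g \<cdot> f) = tgt g" "dgr (g \<cdot> f) = dgr g + dgr f"
  "val (g \<cdot> f) w = app g (val f w)"
  by (simp_all add: gcomp_def)

lemma gtensor_components [simp]:
  "src (f \<otimes> g) = src f + src g" "tgt (f \<otimes> g) = tgt f + tgt g" "dgr (f \<otimes> g) = dgr f + dgr g"
  by (simp_all add: gtensor_def)

lemma val_gtensor:
  "val (f \<otimes> g) w = scl (ksign (dgr g * wdeg (take (src f) w)))
     (conc (val f (take (src f) w)) (val g (drop (src f) w)))"
  by (simp add: gtensor_def Let_def)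

lemma gpower_simps [simp]:
  "gpower f 0 = gid 0" "gpower f (Suc k) = f \<otimes> gpower f k"
  by (simp_all add: gpower_def gtensors_def)

lemma gpower_components [simp]:
  "src (gpower f k) = k * src f" "tgt (gpower f k) = k * tgt f" "dgr (gpower f k) = int k * dgr f"
  by (induction k) (simp_all add: algebra_simps)

lemma val_gid [simp]: "val (gid k) w = Poly_Mapping.single w 1"
  by (simp add: gid_def)

lemma val_gpower_id [unfolded One_nat_def, simp]: "val (gpower \<one> k) w = Poly_Mapping.single w 1"
proof (induction k arbitrary: w)
  case 0
  show ?case by simp
next
  case (Suc k)
  then show ?case
    by (simp add: val_gtensor ksign_def)
qed

lemma val_insert_map:
  assumes "dgr f = 0" "length a = i" "length b = src f"
  shows "val (insert_map f i j) (a @ b @ c)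
    = conc (Poly_Mapping.single a 1) (conc (val f b) (Poly_Mapping.single c 1))"
  using assms by (simp add: insert_map_def val_gtensor ksign_def)

end


section \<open>Maps with values divisible by \<open>x\<close>\<close>

definition x_divisible :: "('b, 'r::comm_ring_1) tensor \<Rightarrow> bool"
  where "x_divisible v \<longleftrightarrow> (\<forall>w. const_part (Poly_Mapping.lookup v w) = 0)"

definition x_valued :: "('b, 'r::comm_ring_1) gmap \<Rightarrow> bool"
  where "x_valued f \<longleftrightarrow> (\<forall>w. x_divisible (val f w))"

lemma mult_eq_0_if_const_parts_0:
  "const_part a = 0 \<Longrightarrow> const_part b = 0 \<Longrightarrow> a * b = (0 :: 'r::comm_ring_1 exterior)"
  by (simp add: times_exterior_def zero_exterior_def)

lemma x_divisible_0 [simp]: "x_divisible 0"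
  by (simp add: x_divisible_def)

lemma x_divisible_single [simp]:
  "x_divisible (Poly_Mapping.single w c) \<longleftrightarrow> const_part c = 0"
  by (auto simp: x_divisible_def lookup_single when_def)

lemma x_divisible_minus: "x_divisible u \<Longrightarrow> x_divisible v \<Longrightarrow> x_divisible (u - v)"
  by (simp add: x_divisible_def lookup_minus)

lemma x_divisible_scl: "x_divisible v \<Longrightarrow> x_divisible (scl c v)"
  by (simp add: x_divisible_def)

lemma x_divisible_sum: "(\<And>a. a \<in> A \<Longrightarrow> x_divisible (F a)) \<Longrightarrow> x_divisible (sum F A)"
  by (simp add: x_divisible_def lookup_sum)
    (induction A rule: infinite_finite_induct; simp)

lemma scl_eq_0_if_x_divisible: "const_part c = 0 \<Longrightarrow> x_divisible v \<Longrightarrow> scl c v = 0"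
  by (rule poly_mapping_eqI) (simp add: x_divisible_def mult_eq_0_if_const_parts_0)

lemma x_valued_lincomb:
  "(\<And>a. a \<in> A \<Longrightarrow> x_valued (F a)) \<Longrightarrow> x_valued (lincomb k l d A s F)"
  by (simp add: x_valued_def lincomb_def x_divisible_sum x_divisible_scl)

lemma x_valued_gminus: "x_valued f \<Longrightarrow> x_valued g \<Longrightarrow> x_valued (f \<ominus> g)"
  by (simp add: x_valued_def gminus_def x_divisible_minus)

context koszul
begin

lemma x_divisible_app:
  assumes "x_valued f \<or> x_divisible v"
  shows "x_divisible (app f v)"
  using assms unfolding app_def
  by (intro x_divisible_sum) (auto simp: x_valued_def x_divisible_def)

lemma app_eq_0_if_x_valued:
  assumes "x_valued f" "x_divisible v"
  shows "app f v = 0"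
  using assms unfolding app_def
  by (intro sum.neutral ballI scl_eq_0_if_x_divisible) (auto simp: x_valued_def x_divisible_def)

lemma x_divisible_conc:
  assumes "x_divisible s \<or> x_divisible t"
  shows "x_divisible (conc s t)"
  using assms unfolding conc_def
  by (intro x_divisible_sum) (auto simp: x_divisible_def lookup_single when_def)

lemma conc_eq_0_if_x_divisible:
  assumes "x_divisible s" "x_divisible t"
  shows "conc s t = 0"
  using assms unfolding conc_def
  by (intro sum.neutral ballI)
    (simp add: x_divisible_def mult_eq_0_if_const_parts_0)

lemma x_valued_gcomp: "x_valued f \<or> x_valued g \<Longrightarrow> x_valued (g \<cdot> f)"
  by (auto simp: x_valued_def intro!: x_divisible_app)

lemma x_valued_gtensor: "x_valued f \<or> x_valued g \<Longrightarrow> x_valued (f \<otimes> g)"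
  by (auto simp: x_valued_def val_gtensor intro!: x_divisible_scl x_divisible_conc)

lemma x_valued_gtensors: "f \<in> set fs \<Longrightarrow> x_valued f \<Longrightarrow> x_valued (gtensors fs)"
  by (induction fs) (auto simp: gtensors_def x_valued_gtensor)

text \<open>Each of the two maps contributes a factor \<open>x\<close>, and \<open>x\<^sup>2 = 0\<close>.\<close>

lemma gzero_gcomp: "x_valued g \<Longrightarrow> x_valued f \<Longrightarrow> gzero (g \<cdot> f)"
  by (simp add: gzero_def app_eq_0_if_x_valued x_valued_def)

lemma val_gtensor_x_valued: "x_valued f \<Longrightarrow> x_valued g \<Longrightarrow> val (f \<otimes> g) w = 0"
  by (simp add: val_gtensor conc_eq_0_if_x_divisible x_valued_def)

lemma x_valued_single_sum: "x_valued \<omega> \<Longrightarrow> x_valued (single_sum \<theta> \<omega> N s)"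
  unfolding single_sum_def by (intro x_valued_lincomb) (simp add: x_valued_gtensor)

text \<open>As \<open>k < N\<close>, some factor of every summand is \<open>\<omega>\<close>.\<close>

lemma x_valued_mixed_sum:
  assumes "x_valued \<omega>" "k < N"
  shows "x_valued (mixed_sum \<theta> \<omega> N k s)"
  unfolding mixed_sum_def
proof (rule x_valued_lincomb)
  fix A assume "A \<in> {A. A \<subseteq> {..<N} \<and> card A = k}"
  then have "A \<noteq> {..<N}" "A \<subseteq> {..<N}"
    using assms(2) by auto
  then obtain i where "i < N" "i \<notin> A"
    by auto
  then show "x_valued (gtensors (map (\<lambda>i. if i \<in> A then \<theta> else \<omega>) [0..<N]))"
    by (intro x_valued_gtensors[OF _ assms(1)]) force
qed

end


section \<open>Product and coproduct on \<open>E(y)\<close>\<close>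

locale exterior_on_y = koszul p "ydeg q" for p :: int and q :: nat
begin

notation gcomp (infixl \<open>\<cdot>\<close> 70)
notation gtensor (infixr \<open>\<otimes>\<close> 75)

lemma wdeg_simps [simp]: "wdeg [] = 0" "wdeg (One # w) = wdeg w" "wdeg (Y # w) = int q + wdeg w"
  "wdeg (replicate k One) = 0" "wdeg (replicate k Y) = int k * int q"
  by (simp_all add: wdeg_def ydeg_def sum_list_replicate)

lemma components [simp]:
  "src primitive_coproduct = 1" "tgt primitive_coproduct = 2" "dgr primitive_coproduct = 0"
  "src trivial_product = 2" "tgt trivial_product = 1" "dgr trivial_product = 0"
  "src (omega m n) = m" "tgt (omega m n) = n" "dgr (omega m n) = int m + int n - 3"
  by (simp_all add: primitive_coproduct_def trivial_product_def omega_def)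

lemma val_primitive_coproduct [simp]:
  "val primitive_coproduct [One] = Poly_Mapping.single [One, One] 1"
  "val primitive_coproduct [Y] = Poly_Mapping.single [One, Y] 1 + Poly_Mapping.single [Y, One] 1"
  by (simp_all add: primitive_coproduct_def)

lemma val_trivial_product [simp]:
  "val trivial_product [One, a] = Poly_Mapping.single [a] 1"
  "val trivial_product [a, One] = Poly_Mapping.single [a] 1"
  "val trivial_product [Y, Y] = 0"
  by (cases a; simp add: trivial_product_def)+

lemma val_omega:
  "val (omega m n) w = (if w = replicate m Y then Poly_Mapping.single (replicate n Y) ext_x else 0)"
  by (simp add: omega_def)

lemma x_valued_omega: "x_valued (omega m n)"
  by (simp add: x_valued_def val_omega)

lemma iter_coproduct_components [simp]:
  "0 < n \<Longrightarrow> src (iter_coproduct primitive_coproduct n) = 1"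
  "0 < n \<Longrightarrow> tgt (iter_coproduct primitive_coproduct n) = n"
  "dgr (iter_coproduct primitive_coproduct n) = 0"
  by (induction primitive_coproduct n rule: iter_coproduct.induct) simp_all

lemma iter_product_components [simp]:
  "0 < n \<Longrightarrow> src (iter_product trivial_product n) = n"
  "0 < n \<Longrightarrow> tgt (iter_product trivial_product n) = 1"
  "dgr (iter_product trivial_product n) = 0"
  by (induction trivial_product n rule: iter_product.induct) simp_all

lemma val_iter_coproduct_One:
  "0 < n \<Longrightarrow> val (iter_coproduct primitive_coproduct n) [One] = Poly_Mapping.single (replicate n One) 1"
  by (induction primitive_coproduct n rule: iter_coproduct.induct) (simp_all add: val_gtensor ksign_def)

lemma val_iter_product_One:
  "0 < n \<Longrightarrow> val (iter_product trivial_product n) (replicate n One) = Poly_Mapping.single [One] 1"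
  by (induction trivial_product n rule: iter_product.induct) (simp_all add: val_gtensor ksign_def)

text \<open>The first factor of \<open>f\<^sup>n(y)\<close> is split next: the word starting with \<open>y\<close> becomes two words, and every
  other one only gains a leading \<open>1\<close>.\<close>

lemma val_iter_coproduct_Y:
  "0 < n \<Longrightarrow> val (iter_coproduct primitive_coproduct n) [Y] =
    (\<Sum>j<n. Poly_Mapping.single (replicate j One @ Y # replicate (n - 1 - j) One) 1)"
proof (induction primitive_coproduct n rule: iter_coproduct.induct)
  case (3 k)
  show ?case
    by (simp add: 3 app_sum sum.lessThan_Suc_shift del: sum.lessThan_Suc)
      (simp add: val_gtensor ksign_def ac_simps)
qed simp_all

text \<open>The letter \<open>1\<close> has degree 0, so moving it past another factor costs no sign.\<close>

lemma permutation_sign_One: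
  assumes "\<And>s t. s < t \<Longrightarrow> t < N \<Longrightarrow> \<pi> t < \<pi> s \<Longrightarrow> w ! \<pi> s = One \<or> w ! \<pi> t = One"
  shows "val (permute_factors N \<pi>) w = Poly_Mapping.single (map (\<lambda>t. w ! \<pi> t) [0..<N]) 1"
  unfolding permute_factors_def gmap.sel
  by (intro arg_cong[where f = "Poly_Mapping.single _"] prod.neutral)
     (use assms in \<open>fastforce simp: ydeg_def ksign_def\<close>)

lemma sigma_components [simp]:
  "src (\<sigma> a b) = a * b" "tgt (\<sigma> a b) = a * b" "dgr (\<sigma> a b) = 0"
  by (simp_all add: \<sigma>_def permute_factors_def)


section \<open>The coproduct relation\<close>

text \<open>The cancellation behind both linear relations.  \<open>E j\<close> will be the contribution of the word with a
  single \<open>1\<close> that is preceded by \<open>j\<close> letters \<open>y\<close>.\<close>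

lemma alternating_telescope:
  "(\<Sum>i=1..n. scl (of_int ((- 1) ^ (i + 1))) (E (i - 1) + E i))
     = (E 0 :: ('b, 'r::comm_ring_1) tensor) + scl (of_int ((- 1) ^ (n + 1))) (E n)"
proof (induction n)
  case 0
  show ?case
    by (rule poly_mapping_eqI) (simp add: lookup_add)
next
  case (Suc n)
  show ?case
    unfolding sum.atLeast_Suc_atMost_Suc_shift
    using Suc by (intro poly_mapping_eqI) (simp add: lookup_add algebra_simps)
qed

text \<open>The words occurring in \<open>\<Delta>\<^bsup>\<otimes>m\<^esup>(w)\<close>, each with coefficient 1.\<close>

fun split_words :: "ybasis list \<Rightarrow> ybasis list set" where
  "split_words [] = {[]}"
| "split_words (One # w) = (\<lambda>u. One # One # u) ` split_words w"
| "split_words (Y # w) = (\<lambda>u. One # Y # u) ` split_words w \<union> (\<lambda>u. Y # One # u) ` split_words w"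

lemma finite_split_words [simp]: "finite (split_words w)"
  by (induction w rule: split_words.induct) simp_all

lemma split_words_iff:
  "u \<in> split_words w \<longleftrightarrow> length u = 2 * length w \<and>
     (\<forall>i<length w. (u ! (2 * i), u ! (2 * i + 1)) \<in>
        (if w ! i = One then {(One, One)} else {(One, Y), (Y, One)}))"
proof (induction w arbitrary: u rule: split_words.induct)
  case 1
  then show ?case by auto
next
  case (2 w)
  show ?case
    by (cases u rule: remdups_adj.cases) (auto simp: 2 image_iff All_less_Suc2)
next
  case (3 w)
  show ?case
    by (cases u rule: remdups_adj.cases) (auto simp: 3 image_iff All_less_Suc2)
qed

lemma val_gpower_coproduct:
  "val (gpower primitive_coproduct (length w)) w = (\<Sum>u\<in>split_words w. Poly_Mapping.single u 1)"
proof (induction w rule: split_words.induct)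
  case 1
  then show ?case by simp
next
  case (2 w)
  then show ?case
    by (simp add: val_gtensor ksign_def conc_sum2 sum.reindex inj_on_def)
next
  case (3 w)
  then show ?case
    by (subst split_words.simps, subst sum.union_disjoint)
     (auto simp: val_gtensor ksign_def conc_sum2 sum.reindex inj_on_def sum.distrib)
qed

definition evens :: "ybasis list \<Rightarrow> ybasis list"
  where "evens u = map (\<lambda>i. u ! (2 * i)) [0..<length u div 2]"

definition odds :: "ybasis list \<Rightarrow> ybasis list"
  where "odds u = map (\<lambda>i. u ! (2 * i + 1)) [0..<length u div 2]"

lemma length_evens_odds [simp]: "length (evens u) = length u div 2" "length (odds u) = length u div 2"
  by (simp_all add: evens_def odds_def)

text \<open>\<open>\<sigma>\<^bsub>2,m\<^esub>\<close> collects the first letters of the \<open>m\<close> pairs in front of the second letters.\<close>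

lemma sigma_2_word:
  assumes "length u = 2 * m"
  shows "map (\<lambda>t. u ! (t mod m * 2 + t div m)) [0..<2 * m] = evens u @ odds u"
proof (rule nth_equalityI)
  fix t assume "t < length (map (\<lambda>t. u ! (t mod m * 2 + t div m)) [0..<2 * m])"
  then have t: "t < 2 * m" by simp
  show "map (\<lambda>t. u ! (t mod m * 2 + t div m)) [0..<2 * m] ! t = (evens u @ odds u) ! t"
  proof (cases "t < m")
    case True
    then show ?thesis by (simp add: evens_def assms nth_append mult.commute)
  next
    case False
    then obtain s where "t = m + s" "s < m"
      using t by (metis add_less_cancel_left le_Suc_ex linorder_not_less mult_2)
    then show ?thesis by (simp add: evens_def odds_def assms nth_append mult.commute)
  qed
qed (simp add: evens_def odds_def assms)

text \<open>The unspecified coefficient is a sign; this is enough for words on which the next map vanishes.\<close>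

lemma val_sigma_2:
  assumes "length u = 2 * m"
  obtains c where "val (\<sigma> 2 m) u = Poly_Mapping.single (evens u @ odds u) c"
  using sigma_2_word[OF assms] by (simp add: \<sigma>_def permute_factors_def)

lemma val_sigma_2_One:
  assumes u: "length u = 2 * m"
    and One: "(\<forall>i<m. u ! (2 * i) = One) \<or> (\<forall>i<m. u ! (2 * i + 1) = One)"
  shows "val (\<sigma> 2 m) u = Poly_Mapping.single (evens u @ odds u) 1"
  unfolding \<sigma>_def
proof (subst permutation_sign_One)
  fix s t assume st: "s < t" "t < 2 * m" "t mod m * 2 + t div m < s mod m * 2 + s div m"
  \<comment> \<open>The permutation is increasing on each half of the target, hence an inversion exchanges a
    first letter of one pair with a second letter of another.\<close>
  have "s < m \<and> m \<le> t"
  proof (rule ccontr)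
    assume "\<not> (s < m \<and> m \<le> t)"
    then consider "t < m" | "m \<le> s" by linarith
    then show False
    proof cases
      case 1
      with st show False by simp
    next
      case 2
      then obtain s' t' where "s = m + s'" "t = m + t'"
        using st(1) by (metis le_Suc_ex le_trans less_imp_le)
      with st show False by simp
    qed
  qed
  moreover from this obtain t' where "t = m + t'"
    using le_Suc_ex by blast
  ultimately have "s mod m * 2 + s div m = 2 * s" "t mod m * 2 + t div m = 2 * t' + 1" "s < m" "t' < m"
    using st(2) by auto
  then show "u ! (s mod m * 2 + s div m) = One \<or> u ! (t mod m * 2 + t div m) = One"
    using One by (auto simp: mult.commute)
qed (simp add: sigma_2_word[OF u])

definition alternating :: "nat \<Rightarrow> ybasis \<Rightarrow> ybasis \<Rightarrow> ybasis list"
  where "alternating m a b = map (\<lambda>t. if even t then a else b) [0..<2 * m]"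

lemma length_alternating [simp]: "length (alternating m a b) = 2 * m"
  by (simp add: alternating_def)

lemma nth_alternating [simp]:
  "i < m \<Longrightarrow> alternating m a b ! (2 * i) = a"
  "i < m \<Longrightarrow> alternating m a b ! Suc (2 * i) = b"
  by (simp_all add: alternating_def)

lemma alternating_eqI:
  assumes "length u = 2 * m" "\<And>i. i < m \<Longrightarrow> u ! (2 * i) = a \<and> u ! (2 * i + 1) = b"
  shows "u = alternating m a b"
proof (rule nth_equalityI)
  fix t assume "t < length u"
  then show "u ! t = alternating m a b ! t"
    using assms by (cases "even t") (auto elim!: evenE oddE)
qed (simp add: assms)

lemma evens_odds_alternating [simp]:
  "evens (alternating m a b) = replicate m a" "odds (alternating m a b) = replicate m b"
  by (auto intro!: nth_equalityI simp: evens_def odds_def)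

lemma alternating_in_split_words_iff:
  "alternating (length w) One Y \<in> split_words w \<longleftrightarrow> w = replicate (length w) Y"
  "alternating (length w) Y One \<in> split_words w \<longleftrightarrow> w = replicate (length w) Y"
  unfolding split_words_iff list_eq_iff_nth_eq[of w]
  by (auto, (metis ybasis.exhaust)+)

text \<open>Primitivity of \<open>y\<close> makes the argument of \<open>\<omega>\<close> determine the whole split word: a letter \<open>y\<close> is
  always paired with \<open>1\<close>.\<close>

lemma odds_split_word:
  assumes "u \<in> split_words w" "odds u = replicate (length w) Y"
  shows "u = alternating (length w) One Y"
proof (rule alternating_eqI)
  show "length u = 2 * length w"
    using assms(1) by (simp add: split_words_iff)
  fix i assume i: "i < length w"
  have "odds u ! i = Y"
    using assms(2) i by simp
  then show "u ! (2 * i) = One \<and> u ! (2 * i + 1) = Y"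
    using assms(1) i by (auto simp: split_words_iff odds_def split: if_splits)
qed

lemma evens_split_word:
  assumes "u \<in> split_words w" "evens u = replicate (length w) Y"
  shows "u = alternating (length w) Y One"
proof (rule alternating_eqI)
  show "length u = 2 * length w"
    using assms(1) by (simp add: split_words_iff)
  fix i assume i: "i < length w"
  have "evens u ! i = Y"
    using assms(2) i by simp
  then show "u ! (2 * i) = Y \<and> u ! (2 * i + 1) = One"
    using assms(1) i by (auto simp: split_words_iff evens_def split: if_splits)
qed

text \<open>If \<open>\<omega>\<close> is nonzero on the second letters, they are all \<open>y\<close> and \<open>g\<^sub>m\<close> receives \<open>1|\<dots>|1\<close>.  The next
  lemma is the mirror image.\<close>

lemma product_omega_on_split:
  assumes "u \<in> split_words w" "length w = m" "0 < m"
  shows "app (iter_product trivial_product m \<otimes> omega m n) (val (\<sigma> 2 m) u)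
    = (if u = alternating m One Y
         then Poly_Mapping.single (One # replicate n Y) (ext_x :: 'r::comm_ring_1 exterior) else 0)"
proof (cases "u = alternating m One Y")
  case True
  then show ?thesis
    using assms(3) by (subst val_sigma_2_One[where m = m])
      (auto simp: val_gtensor val_iter_product_One val_omega ksign_def)
next
  case False
  have u: "length u = 2 * m"
    using assms by (simp add: split_words_iff)
  obtain c :: "'r exterior" where "val (\<sigma> 2 m) u = Poly_Mapping.single (evens u @ odds u) c"
    using val_sigma_2[OF u] .
  moreover have "odds u \<noteq> replicate m Y"
    using odds_split_word assms False by auto
  ultimately show ?thesis
    using False u assms by (simp add: val_gtensor val_omega)
qed

lemma omega_product_on_split:
  assumes "u \<in> split_words w" "length w = m" "0 < m"
  shows "app (omega m n \<otimes> iter_product trivial_product m) (val (\<sigma> 2 m) u)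
    = (if u = alternating m Y One
         then Poly_Mapping.single (replicate n Y @ [One]) (ext_x :: 'r::comm_ring_1 exterior) else 0)"
proof (cases "u = alternating m Y One")
  case True
  then show ?thesis
    using assms(3) by (subst val_sigma_2_One[where m = m])
      (auto simp: val_gtensor val_iter_product_One val_omega ksign_def)
next
  case False
  have u: "length u = 2 * m"
    using assms by (simp add: split_words_iff)
  obtain c :: "'r exterior" where "val (\<sigma> 2 m) u = Poly_Mapping.single (evens u @ odds u) c"
    using val_sigma_2[OF u] .
  moreover have "evens u \<noteq> replicate m Y"
    using evens_split_word assms False by auto
  ultimately show ?thesis
    using False u assms by (simp add: val_gtensor val_omega)
qed

text \<open>The two words are neighbours in the sense of \<open>alternating_telescope\<close>: they are \<open>E j\<close> and \<open>E (j + 1)\<close>.\<close>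

lemma insert_coproduct_Ys:
  "val (insert_map primitive_coproduct j k) (replicate (j + Suc k) Y)
    = Poly_Mapping.single (replicate j Y @ One # replicate (Suc k) Y) 1
      + Poly_Mapping.single (replicate (Suc j) Y @ One # replicate k Y) 1"
proof -
  have Ys: "replicate (j + Suc k) Y = replicate j Y @ [Y] @ replicate k Y"
    by (simp add: replicate_add replicate_app_Cons_same)
  show ?thesis
    unfolding Ys by (subst val_insert_map) (simp_all add: replicate_app_Cons_same)
qed

lemma coproduct_relation:
  assumes "0 < m" "0 < n"
  shows "cobar primitive_coproduct n \<cdot> (omega m n :: (ybasis, 'r::comm_ring_1) gmap) \<approx>
    (iter_product trivial_product m \<otimes> omega m n
       \<ominus> gscale ((- 1) ^ n) (omega m n \<otimes> iter_product trivial_product m))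
      \<cdot> \<sigma> 2 m \<cdot> gpower primitive_coproduct m"
  unfolding geq_def
proof (intro conjI allI impI)
  let ?g = "iter_product trivial_product m :: (ybasis, 'r) gmap"
  let ?\<omega> = "omega m n :: (ybasis, 'r) gmap"
  let ?E = "\<lambda>j. Poly_Mapping.single (replicate j Y @ One # replicate (n - j) Y) 1 :: (ybasis, 'r) tensor"
  fix w :: "ybasis list"
  assume "length w = src (cobar primitive_coproduct n \<cdot> ?\<omega>)"
  then have w: "length w = m" by simp
  have "val (cobar primitive_coproduct n) (replicate n Y)
      = (\<Sum>i=1..n. scl (of_int ((- 1) ^ (i + 1))) (?E (i - 1) + ?E i))"
    unfolding cobar_def val_lincomb
  proof (rule sum.cong)
    fix i assume "i \<in> {1..n}"
    then obtain j k where jk: "i = Suc j" "n = j + Suc k"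
      by (metis One_nat_def Suc_le_D add_Suc_shift atLeastAtMost_iff le_Suc_ex)
    show "scl (of_int ((- 1) ^ (i + 1)))
         (val (insert_map primitive_coproduct (i - 1) (n - i)) (replicate n Y))
        = scl (of_int ((- 1) ^ (i + 1))) (?E (i - 1) + ?E i)"
      by (simp add: jk insert_coproduct_Ys[simplified])
  qed simp
  also have "\<dots> = ?E 0 + scl (of_int ((- 1) ^ (n + 1))) (?E n)"
    by (rule alternating_telescope)
  finally have lhs: "val (cobar primitive_coproduct n \<cdot> ?\<omega>) w =
      (if w = replicate m Y then scl ext_x (?E 0 + scl (of_int ((- 1) ^ (n + 1))) (?E n)) else 0)"
    by (simp add: val_omega cobar_def)
  have "val (gpower primitive_coproduct m) w
      = (\<Sum>u\<in>split_words w. Poly_Mapping.single u (1 :: 'r exterior))"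
    unfolding w[symmetric] by (rule val_gpower_coproduct)
  then have "val ((?g \<otimes> ?\<omega> \<ominus> gscale ((- 1) ^ n) (?\<omega> \<otimes> ?g)) \<cdot> \<sigma> 2 m \<cdot> gpower primitive_coproduct m) w
     = (\<Sum>u\<in>split_words w. app (?g \<otimes> ?\<omega>) (val (\<sigma> 2 m) u))
       - scl (of_int ((- 1) ^ n)) (\<Sum>u\<in>split_words w. app (?\<omega> \<otimes> ?g) (val (\<sigma> 2 m) u))"
    by (simp add: app_sum app_gminus app_gscale sum_subtractf scl_sum)
  also have "\<dots> = (if w = replicate m Y then Poly_Mapping.single (One # replicate n Y) ext_x
        - scl (of_int ((- 1) ^ n)) (Poly_Mapping.single (replicate n Y @ [One]) ext_x) else 0)"
    using alternating_in_split_words_iff[of w] assms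
    by (simp add: product_omega_on_split[OF _ w] omega_product_on_split[OF _ w] w)
  finally show "val (cobar primitive_coproduct n \<cdot> ?\<omega>) w =
      val ((?g \<otimes> ?\<omega> \<ominus> gscale ((- 1) ^ n) (?\<omega> \<otimes> ?g)) \<cdot> \<sigma> 2 m \<cdot> gpower primitive_coproduct m) w"
    unfolding lhs by (auto simp: algebra_simps single_uminus)
qed (use assms in \<open>simp_all add: cobar_def\<close>)


section \<open>The product relation\<close>

text \<open>Multiplying the factors \<open>i\<close> and \<open>i + 1\<close> of \<open>w\<close> yields \<open>y|\<dots>|y\<close> only if one of them is the single \<open>1\<close>
  of \<open>w\<close>.  The two conditions exclude each other; writing the value as a sum of two terms fits it
  to \<open>alternating_telescope\<close>.\<close>

lemma omega_contraction:
  assumes "length w = m + 1" "1 \<le> i" "i \<le> m"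
  shows "app (omega m n) (val (insert_map trivial_product (i - 1) (m - i)) w)
    = (if w = replicate (i - 1) Y @ One # replicate (m - (i - 1)) Y
         then Poly_Mapping.single (replicate n Y) ext_x else 0)
      + (if w = replicate i Y @ One # replicate (m - i) Y
           then Poly_Mapping.single (replicate n Y) (ext_x :: 'r::comm_ring_1 exterior) else 0)"
proof -
  obtain j k where jk: "i = Suc j" "m = j + Suc k"
    using assms(2,3) by (metis One_nat_def Suc_le_D add_Suc_shift le_Suc_ex)
  obtain a b c d where w: "w = a @ [b, c] @ d" and len: "length a = j" "length d = k"
  proof
    show "w = take j w @ [w ! j, w ! Suc j] @ drop (Suc (Suc j)) w"
      using assms(1) jk by (simp add: Cons_nth_drop_Suc)
  qed (use assms(1) jk in auto)
  have m: "replicate m Y = replicate j Y @ Y # replicate k Y"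
    unfolding jk by (simp add: replicate_add replicate_app_Cons_same replicate_append_same)
  have i: "replicate i Y @ One # replicate k Y = replicate j Y @ Y # One # replicate k Y"
    unfolding jk by (simp add: replicate_app_Cons_same replicate_append_same)
  have idx: "i - 1 = j" "m - i = k" "m - j = Suc k"
    using jk by simp_all
  have "val (insert_map trivial_product j k) w
      = conc (Poly_Mapping.single a 1)
         (conc (val trivial_product [b, c]) (Poly_Mapping.single d (1 :: 'r exterior)))"
    unfolding w by (rule val_insert_map) (simp_all add: len)
  then show ?thesis
    unfolding idx i using len by (cases b; cases c) (auto simp: w val_omega m)
qed

lemma bar_side:
  assumes "length w = m + 1"
  shows "val (omega m n \<cdot> bar trivial_product m) w
    = (if w = One # replicate m Y then Poly_Mapping.single (replicate n Y) ext_x else 0)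
      + scl (of_int ((- 1) ^ (m + 1)))
         (if w = replicate m Y @ [One]
            then Poly_Mapping.single (replicate n Y) (ext_x :: 'r::comm_ring_1 exterior) else 0)"
proof -
  let ?E = "\<lambda>j. if w = replicate j Y @ One # replicate (m - j) Y
    then Poly_Mapping.single (replicate n Y) (ext_x :: 'r exterior) else 0"
  have "val (omega m n \<cdot> bar trivial_product m) w
      = (\<Sum>i=1..m. scl (of_int ((- 1) ^ (i + 1))) (?E (i - 1) + ?E i))"
    unfolding bar_def gcomp_components val_lincomb app_sum app_of_int
    by (intro sum.cong refl arg_cong2[where f = scl] omega_contraction) (use assms in auto)
  also have "\<dots> = ?E 0 + scl (of_int ((- 1) ^ (m + 1))) (?E m)"
    by (rule alternating_telescope)
  finally show ?thesis by simp
qed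

lemma val_gpower_product_Y:
  assumes "length w = 2 * n" "\<And>i. i < n \<Longrightarrow> {w ! (2 * i), w ! (2 * i + 1)} = {One, Y}"
  shows "val (gpower trivial_product n) w
    = (Poly_Mapping.single (replicate n Y) 1 :: (ybasis, 'r::comm_ring_1) tensor)"
  using assms
proof (induction n arbitrary: w)
  case 0
  then show ?case by simp
next
  case (Suc n)
  then obtain a b v where w: "w = a # b # v"
    by (auto simp: length_Suc_conv)
  have "val (gpower trivial_product n) v
    = (Poly_Mapping.single (replicate n Y) 1 :: (ybasis, 'r) tensor)"
  proof (rule Suc.IH)
    show "length v = 2 * n"
      using Suc.prems(1) by (simp add: w)
    show "{v ! (2 * i), v ! (2 * i + 1)} = {One, Y}" if "i < n" for i
      using Suc.prems(2)[of "Suc i"] that by (simp add: w)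
  qed
  moreover have "a = One \<and> b = Y \<or> a = Y \<and> b = One"
    using Suc.prems(2)[of 0] by (auto simp: w doubleton_eq_iff)
  ultimately show ?case
    by (auto simp: w val_gtensor ksign_def)
qed

lemma val_gpower_product_eq_0:
  assumes "length w = 2 * n" "i < n" "w ! (2 * i) = Y" "w ! (2 * i + 1) = Y"
  shows "val (gpower trivial_product n) w = 0"
  using assms
proof (induction n arbitrary: w i)
  case 0
  then show ?case by simp
next
  case (Suc n)
  then obtain a b v where w: "w = a # b # v"
    by (auto simp: length_Suc_conv)
  show ?case
  proof (cases i)
    case 0
    with Suc.prems show ?thesis by (simp add: w val_gtensor)
  next
    case (Suc j)
    with Suc.prems Suc.IH[of v j] show ?thesis by (simp add: w val_gtensor)
  qed
qed

text \<open>\<open>\<sigma>\<^bsub>n,2\<^esub>\<close> interleaves its two blocks, so that \<open>\<mu>\<^bsup>\<otimes>n\<^esup>\<close> multiplies them letter by letter.\<close>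

lemma sigma_n_2_word:
  assumes "length u = n" "length v = n"
  shows "length (map (\<lambda>t. (u @ v) ! (t mod 2 * n + t div 2)) [0..<n * 2]) = 2 * n"
    "i < n \<Longrightarrow> map (\<lambda>t. (u @ v) ! (t mod 2 * n + t div 2)) [0..<n * 2] ! (2 * i) = u ! i"
    "i < n \<Longrightarrow> map (\<lambda>t. (u @ v) ! (t mod 2 * n + t div 2)) [0..<n * 2] ! (2 * i + 1) = v ! i"
  using assms by (simp_all add: nth_append)

lemma product_sigma_n_2_eq_0:
  assumes "length u = n" "length v = n" "i < n" "u ! i = Y" "v ! i = Y"
  shows "app (gpower trivial_product n) (val (\<sigma> n 2) (u @ v))
    = (0 :: (ybasis, 'r::comm_ring_1) tensor)"
proof -
  have "val (gpower trivial_product n) (map (\<lambda>t. (u @ v) ! (t mod 2 * n + t div 2)) [0..<n * 2])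
      = (0 :: (ybasis, 'r) tensor)"
    by (rule val_gpower_product_eq_0[of _ _ i]) (simp_all only: sigma_n_2_word assms)
  then show ?thesis
    by (simp add: \<sigma>_def permute_factors_def)
qed

lemma product_sigma_n_2_Y:
  assumes uv: "u = replicate n One \<and> v = replicate n Y \<or> u = replicate n Y \<and> v = replicate n One"
  shows "app (gpower trivial_product n) (val (\<sigma> n 2) (u @ v))
    = (Poly_Mapping.single (replicate n Y) 1 :: (ybasis, 'r::comm_ring_1) tensor)"
proof -
  let ?w = "map (\<lambda>t. (u @ v) ! (t mod 2 * n + t div 2)) [0..<n * 2]"
  have len: "length u = n" "length v = n"
    using uv by auto
  have "val (\<sigma> n 2) (u @ v) = (Poly_Mapping.single ?w 1 :: (ybasis, 'r) tensor)"
    unfolding \<sigma>_def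
  proof (rule permutation_sign_One)
    fix s t assume st: "s < t" "t < n * 2" "t mod 2 * n + t div 2 < s mod 2 * n + s div 2"
    \<comment> \<open>The order of letters of the same block is kept, hence an inversion pairs a letter of \<open>v\<close>
      with a letter of \<open>u\<close>.\<close>
    have "s mod 2 = 1 \<and> t mod 2 = 0"
    proof (rule ccontr)
      assume "\<not> (s mod 2 = 1 \<and> t mod 2 = 0)"
      then have "s mod 2 * n \<le> t mod 2 * n"
        by (intro mult_right_mono) auto
      with st(1,3) show False
        by (meson add_mono div_le_mono less_imp_le linorder_not_less)
    qed
    then show "(u @ v) ! (s mod 2 * n + s div 2) = One \<or> (u @ v) ! (t mod 2 * n + t div 2) = One"
      using st(1,2) uv by (auto simp: nth_append)
  qed
  moreover have "val (gpower trivial_product n) ?w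
      = (Poly_Mapping.single (replicate n Y) 1 :: (ybasis, 'r) tensor)"
  proof (rule val_gpower_product_Y)
    fix i assume "i < n"
    then show "{?w ! (2 * i), ?w ! (2 * i + 1)} = {One, Y}"
      using uv unfolding sigma_n_2_word(2,3)[OF len \<open>i < n\<close>] by auto
  qed (simp only: sigma_n_2_word[OF len])
  ultimately show ?thesis by simp
qed

text \<open>These are the words obtained from the summands of \<open>f\<^sup>n(y)\<close> and \<open>\<omega>(y|\<dots>|y)\<close>; the single \<open>y\<close> from
  \<open>f\<^sup>n(y)\<close> meets another \<open>y\<close>, and \<open>\<mu>(y|y) = 0\<close>.\<close>

lemma product_sigma_n_2_single_Y:
  assumes "j < n"
  shows "app (gpower trivial_product n)
      (val (\<sigma> n 2) (replicate j One @ Y # replicate (n - Suc j) One @ replicate n Y))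
    = (0 :: (ybasis, 'r::comm_ring_1) tensor)"
    "app (gpower trivial_product n)
      (val (\<sigma> n 2) (replicate n Y @ replicate j One @ Y # replicate (n - Suc j) One))
    = (0 :: (ybasis, 'r::comm_ring_1) tensor)"
  using product_sigma_n_2_eq_0[of "replicate j One @ Y # replicate (n - Suc j) One" n "replicate n Y" j]
    product_sigma_n_2_eq_0[of "replicate n Y" n "replicate j One @ Y # replicate (n - Suc j) One" j]
    assms
  by (simp_all add: nth_append)

text \<open>\<open>f\<^sup>n(1) = 1|\<dots>|1\<close> acts as a unit, whereas \<open>f\<^sup>n(y)\<close> annihilates the value of \<open>\<omega>\<close>.\<close>

lemma coproduct_omega_product:
  assumes w: "length w = m + 1" and "0 < n"
  shows "app (gpower trivial_product n \<cdot> \<sigma> n 2) (val (iter_coproduct primitive_coproduct n \<otimes> omega m n) w)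
    = (if w = One # replicate m Y
         then Poly_Mapping.single (replicate n Y) (ext_x :: 'r::comm_ring_1 exterior) else 0)"
proof -
  obtain a v where av: "w = a # v"
    using w by (cases w) auto
  show ?thesis
  proof (cases "v = replicate m Y \<and> a = Y")
    case True
    then show ?thesis
      using assms(2)
      by (simp add: av val_gtensor val_iter_coproduct_Y val_omega conc_sum1 scl_sum app_sum
          product_sigma_n_2_single_Y)
  next
    case False
    then show ?thesis
      using assms(2)
      by (cases a) (auto simp: product_sigma_n_2_Y av val_gtensor val_iter_coproduct_One val_omega ksign_def)
  qed
qed

lemma omega_coproduct_product:
  assumes w: "length w = m + 1" and "0 < n"
  shows "app (gpower trivial_product n \<cdot> \<sigma> n 2) (val (omega m n \<otimes> iter_coproduct primitive_coproduct n) w)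
    = (if w = replicate m Y @ [One]
         then Poly_Mapping.single (replicate n Y) (ext_x :: 'r::comm_ring_1 exterior) else 0)"
proof -
  obtain v a where va: "w = v @ [a]" "length v = m"
    using w by (cases w rule: rev_cases) auto
  show ?thesis
  proof (cases "v = replicate m Y \<and> a = Y")
    case True
    then show ?thesis
      using assms(2)
      by (simp add: va val_gtensor val_iter_coproduct_Y val_omega conc_sum2 scl_sum app_sum
          product_sigma_n_2_single_Y)
  next
    case False
    then show ?thesis
      using assms(2) va(2)
      by (cases a) (auto simp: product_sigma_n_2_Y va val_gtensor val_iter_coproduct_One val_omega ksign_def)
  qed
qed

lemma product_relation:
  assumes "0 < m" "0 < n"
  shows "omega m n \<cdot> bar trivial_product m \<approx>
    gpower trivial_product n \<cdot> \<sigma> n 2 \<cdot>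
      (iter_coproduct primitive_coproduct n \<otimes> (omega m n :: (ybasis, 'r::comm_ring_1) gmap)
         \<ominus> gscale ((- 1) ^ m) (omega m n \<otimes> iter_coproduct primitive_coproduct n))"
  unfolding geq_def
proof (intro conjI allI impI)
  let ?f = "iter_coproduct primitive_coproduct n :: (ybasis, 'r) gmap"
  let ?\<omega> = "omega m n :: (ybasis, 'r) gmap"
  fix w :: "ybasis list"
  assume "length w = src (?\<omega> \<cdot> bar trivial_product m)"
  then have w: "length w = m + 1" by (simp add: bar_def)
  have "val (gpower trivial_product n \<cdot> \<sigma> n 2 \<cdot> (?f \<otimes> ?\<omega> \<ominus> gscale ((- 1) ^ m) (?\<omega> \<otimes> ?f))) w
      = app (gpower trivial_product n \<cdot> \<sigma> n 2) (val (?f \<otimes> ?\<omega>) w)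
        - scl (of_int ((- 1) ^ m)) (app (gpower trivial_product n \<cdot> \<sigma> n 2) (val (?\<omega> \<otimes> ?f) w))"
    by (simp only: gcomp_components(4) gminus_def gscale_def gmap.sel app_minus app_of_int)
  then show "val (?\<omega> \<cdot> bar trivial_product m) w
      = val (gpower trivial_product n \<cdot> \<sigma> n 2 \<cdot> (?f \<otimes> ?\<omega> \<ominus> gscale ((- 1) ^ m) (?\<omega> \<otimes> ?f))) w"
    unfolding coproduct_omega_product[OF w assms(2)] omega_coproduct_product[OF w assms(2)]
      bar_side[OF w]
    by (simp add: single_uminus)
qed (use assms in \<open>simp_all add: bar_def\<close>)


section \<open>The Hopf algebra \<open>E(y)\<close>\<close>

lemma all_words_Suc:
  "(\<forall>w. length w = Suc k \<longrightarrow> P w) \<longleftrightarrow>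
     (\<forall>w. length w = k \<longrightarrow> P (One # w)) \<and> (\<forall>w. length w = k \<longrightarrow> P (Y # w))"
  by (auto simp: length_Suc_conv) (metis ybasis.exhaust)

definition unit_map :: "(ybasis, 'r::comm_ring_1) gmap"
  where "unit_map = GMap 0 1 0 (\<lambda>w. Poly_Mapping.single [One] 1)"

definition counit_map :: "(ybasis, 'r::comm_ring_1) gmap"
  where "counit_map = GMap 1 0 0 (\<lambda>w. if w = [One] then Poly_Mapping.single [] 1 else 0)"

definition antipode_map :: "(ybasis, 'r::comm_ring_1) gmap"
  where "antipode_map = GMap 1 1 0 (\<lambda>w. Poly_Mapping.single w (if w = [Y] then - 1 else 1))"

text \<open>The middle two factors are interchanged; this is the only inversion of the permutation.\<close>

lemma val_sigma_2_2:
  "val (\<sigma> 2 2) [a, b, c, d]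
    = Poly_Mapping.single [a, c, b, d] (ksign (ydeg q b * ydeg q c) :: 'r::comm_ring_1 exterior)"
proof -
  have "{(s, t). s < t \<and> t < 4 \<and> t mod 2 * 2 + t div 2 < s mod 2 * 2 + s div 2}
      = Set.filter (\<lambda>(s, t). s < t \<and> t mod 2 * 2 + t div 2 < s mod 2 * 2 + s div 2)
          ({..<4} \<times> {..<4 :: nat})"
    by auto
  also have "\<dots> = {(1, 2)}" by code_simp
  finally show ?thesis
    by (simp add: \<sigma>_def permute_factors_def upt_rec mult.commute)
qed

text \<open>All identities are checked on the finitely many words of the required length.  The unit is \<open>1\<close>, the
  counit kills \<open>y\<close>, and the antipode sends \<open>y\<close> to \<open>-y\<close>.\<close>

lemma hopf_algebra_E_y:
  assumes "odd q \<or> (2 :: 'r::comm_ring_1) = 0"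
  shows "hopf_algebra (primitive_coproduct :: (ybasis, 'r) gmap) trivial_product"
proof -
  \<comment> \<open>In characteristic 2 the sign is immaterial, so \<open>-1\<close> may be used for even \<open>q\<close> as well.\<close>
  have sq: "ksign (int q * int q) = (- 1 :: 'r exterior)"
    using assms
  proof
    assume "(2 :: 'r) = 0"
    then have "(1 :: 'r) = - 1"
      by (metis add_eq_0_iff one_add_one)
    then have "(1 :: 'r exterior) = - 1"
      by (simp add: one_exterior_def uminus_exterior_def)
    then show ?thesis by (simp add: ksign_def)
  qed (simp add: ksign_def)
  note evaluate = geq_def val_gtensor all_words_Suc numeral_2_eq_2 numeral_3_eq_3 sq
    unit_map_def counit_map_def antipode_map_def
  note maps = trivial_product_def primitive_coproduct_def unit_map_def counit_map_def
    antipode_map_def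
  let ?\<mu> = "trivial_product :: (ybasis, 'r) gmap"
  let ?\<Delta> = "primitive_coproduct :: (ybasis, 'r) gmap"
  let ?\<eta> = "unit_map :: (ybasis, 'r) gmap"
  let ?\<epsilon> = "counit_map :: (ybasis, 'r) gmap"
  let ?S = "antipode_map :: (ybasis, 'r) gmap"
  have "?\<mu> \<in> Hom 0 2 1"
    by (auto simp: Hom_def ext_homogeneous_def maps one_exterior_def split: if_splits)
  moreover have "?\<Delta> \<in> Hom 0 1 2"
    by (auto simp: Hom_def ext_homogeneous_def maps one_exterior_def zero_exterior_def
        plus_exterior_def lookup_add lookup_single when_def
        dest!: set_mp[OF Poly_Mapping.keys_add] split: if_splits)
  moreover have "?\<mu> \<cdot> (?\<mu> \<otimes> \<one>) \<approx> ?\<mu> \<cdot> (\<one> \<otimes> ?\<mu>)"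
    by (simp add: evaluate)
  moreover have "(?\<Delta> \<otimes> \<one>) \<cdot> ?\<Delta> \<approx> (\<one> \<otimes> ?\<Delta>) \<cdot> ?\<Delta>"
    by (simp add: evaluate)
  moreover have "?\<Delta> \<cdot> ?\<mu> \<approx> (?\<mu> \<otimes> ?\<mu>) \<cdot> \<sigma> 2 2 \<cdot> (?\<Delta> \<otimes> ?\<Delta>)"
    by (simp add: evaluate val_sigma_2_2[unfolded numeral_2_eq_2] ydeg_def) (simp add: single_uminus)
  moreover have "\<exists>\<eta> \<epsilon> S. \<eta> \<in> Hom 0 0 1 \<and> \<epsilon> \<in> Hom 0 1 0 \<and> S \<in> Hom 0 1 1 \<and>
       ?\<mu> \<cdot> (\<eta> \<otimes> \<one>) \<approx> \<one> \<and> ?\<mu> \<cdot> (\<one> \<otimes> \<eta>) \<approx> \<one> \<and>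
       (\<epsilon> \<otimes> \<one>) \<cdot> ?\<Delta> \<approx> \<one> \<and> (\<one> \<otimes> \<epsilon>) \<cdot> ?\<Delta> \<approx> \<one> \<and>
       ?\<Delta> \<cdot> \<eta> \<approx> \<eta> \<otimes> \<eta> \<and> \<epsilon> \<cdot> ?\<mu> \<approx> \<epsilon> \<otimes> \<epsilon> \<and> \<epsilon> \<cdot> \<eta> \<approx> gid 0 \<and>
       ?\<mu> \<cdot> (S \<otimes> \<one>) \<cdot> ?\<Delta> \<approx> \<eta> \<cdot> \<epsilon> \<and> ?\<mu> \<cdot> (\<one> \<otimes> S) \<cdot> ?\<Delta> \<approx> \<eta> \<cdot> \<epsilon>"
  proof (rule exI[of _ ?\<eta>], rule exI[of _ ?\<epsilon>], rule exI[of _ ?S], intro conjI)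
    show "?\<eta> \<in> Hom 0 0 1" "?\<epsilon> \<in> Hom 0 1 0" "?S \<in> Hom 0 1 1"
      by (auto simp: Hom_def ext_homogeneous_def maps one_exterior_def zero_exterior_def
          uminus_exterior_def split: if_splits)
  qed (simp_all add: evaluate, simp_all add: single_uminus)
  ultimately show ?thesis
    unfolding hopf_algebra_def by blast
qed


section \<open>The \<open>A\<^sub>\<infinity>\<close>-bialgebra\<close>

text \<open>The condition compares the degrees of \<open>y|\<dots>|y\<close> (\<open>m\<close> factors) and \<open>x y|y|\<dots>|y\<close> (\<open>n\<close> factors).\<close>

lemma omega_in_Hom:
  assumes "int m * int q + int m + int n - 3 = p + int n * int q"
  shows "omega m n \<in> Hom (int m + int n - 3) m n"
  using assms by (auto simp: Hom_def val_omega ext_homogeneous_def ext_x_def split: if_splits)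

text \<open>The equation in the hypotheses is the homogeneity of \<open>\<omega>\<close>; it replaces the three families of
  parameters, each of which solves it.\<close>

lemma A_infty_bialgebra_E_y:
  assumes mn: "0 < m" "0 < n" "4 \<le> m + n"
    and degree: "int m * int q + int m + int n - 3 = p + int n * int q"
    and "odd q \<or> (2 :: 'r::comm_ring_1) = 0"
  shows "A_infty_bialgebra m n (primitive_coproduct :: (ybasis, 'r) gmap) trivial_product (omega m n)"
  unfolding A_infty_bialgebra_def Let_def
proof (intro conjI allI impI)
  let ?\<omega> = "omega m n :: (ybasis, 'r) gmap"
  show "hopf_algebra (primitive_coproduct :: (ybasis, 'r) gmap) trivial_product"
    using assms(5) by (rule hopf_algebra_E_y)
  show "?\<omega> \<in> Hom (int m + int n - 3) m n"
    using degree by (rule omega_in_Hom)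
  show "cobar primitive_coproduct n \<cdot> ?\<omega> \<approx> (iter_product trivial_product m \<otimes> ?\<omega>
      \<ominus> gscale ((- 1) ^ n) (?\<omega> \<otimes> iter_product trivial_product m)) \<cdot> \<sigma> 2 m \<cdot> gpower primitive_coproduct m"
    using mn by (intro coproduct_relation) auto
  show "?\<omega> \<cdot> bar trivial_product m \<approx> gpower trivial_product n \<cdot> \<sigma> n 2
      \<cdot> (iter_coproduct primitive_coproduct n \<otimes> ?\<omega>
          \<ominus> gscale ((- 1) ^ m) (?\<omega> \<otimes> iter_coproduct primitive_coproduct n))"
    using mn by (intro product_relation) auto
  show "gzero ((?\<omega> \<otimes> ?\<omega>) \<cdot> \<sigma> 2 2 \<cdot> (primitive_coproduct \<otimes> primitive_coproduct))"
    "gzero ((?\<omega> \<otimes> ?\<omega>) \<cdot> \<sigma> 2 2 \<cdot> (?\<omega> \<otimes> ?\<omega>))"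
    by (simp_all add: gzero_def app_def val_gtensor_x_valued x_valued_omega)
  show "gzero ((trivial_product \<otimes> trivial_product) \<cdot> \<sigma> 2 2 \<cdot> (?\<omega> \<otimes> ?\<omega>))"
    by (simp add: gzero_def val_gtensor_x_valued x_valued_omega)
qed (use mn in \<open>simp_all add: gzero_gcomp x_valued_gcomp x_valued_single_sum x_valued_mixed_sum
      x_valued_gminus x_valued_gtensor x_valued_omega\<close>)

end

theorem theorem1:
  fixes m n p q :: nat
  assumes pos: "0 < m" "0 < n" "0 < p" "0 < q"
    and mn: "m + n \<ge> 4"
    and cases:
      "m = 2 \<and> n = 2 \<and> p = 1 \<and> q \<ge> 2
       \<or> m \<ge> 2 \<and> n \<ge> 1 \<and> int p = 2 * int m - 3 \<and> q = 1
       \<or> m \<ge> 3 \<and> m + 1 \<le> n \<and> int n \<le> 3 * int m - int p - 3 \<and> 1 \<le> p \<and> int p \<le> 2 * int m - 4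
           \<and> real q = (real p - real m - real n + 3) / (real m - real n)"
    and odd_or_two_eq_0: "odd q \<or> (2 :: 'r::comm_ring_1) = 0"
  shows "koszul.A_infty_bialgebra (int p) (ydeg q) m n
           (primitive_coproduct :: (ybasis, 'r) gmap) trivial_product (omega m n)"
proof -
  interpret exterior_on_y "int p" q .
  have "int m * int q + int m + int n - 3 = int p + int n * int q"
    using cases
  proof (elim disjE conjE)
    assume "m + 1 \<le> n" "real q = (real p - real m - real n + 3) / (real m - real n)"
    then have "real q * (real m - real n) = real p - real m - real n + 3"
      by (simp add: field_simps)
    then have "real_of_int (int q * (int m - int n)) = real_of_int (int p - int m - int n + 3)"
      by simp
    then have "int q * (int m - int n) = int p - int m - int n + 3"
      by (simp only: of_int_eq_iff)
    then show ?thesis by (simp add: algebra_simps)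
  qed simp_all
  then show ?thesis
    using pos mn odd_or_two_eq_0 by (intro A_infty_bialgebra_E_y) auto
qed

end
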